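(* Let $n,m,r,s$ be non-negative integers and let $p$ be a prime with $p\nmid m$. Then $$\sum_{k=1}^{p-1}\frac{\mathcal{F}_{n+k}(x;r,s)}{(-m)^k}\equiv (-m)^n\left(\mathcal{F}_{p-1}(x;r+m,s)-s!\right)\pmod{p\mathbb{Z}_p[x]}.$$
   Context: ${n\brace k}_r$ denotes the $r$-Stirling numbers of the second kind: the number of partitions of $\{1,\dots,n\}$ into $k$ nonempty blocks such that $1,\dots,r$ lie in distinct blocks (for $r=0$ these are the ordinary Stirling numbers). The $(r,s)$-Fubini polynomials are $\mathcal{F}_n(x;r,s)=\sum_{k=0}^n {n+r\brace k+r}_r (k+s)!\,x^k$. Here $\mathbb{Z}_p$ is the ring of $p$-adic integers (so $1/(-m)^k\in\mathbb{Z}_p$ as $p\nmid m$), and $A\equiv B\pmod{p\mathbb{Z}_p[x]}$ means corresponding coefficients of $A,B\in\mathbb{Z}_p[x]$ are congruent modulo $p$. *)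

theory Defs
  imports
    "HOL-Library.Disjoint_Sets"
    "HOL-Computational_Algebra.Primes"
    "HOL-Algebra.UnivPoly"
begin

definition r_Stirling2 :: "nat \<Rightarrow> nat \<Rightarrow> nat \<Rightarrow> nat" where
  "r_Stirling2 r n k =
     card {P. partition_on {1..n} P \<and> card P = k \<and>
              (\<forall>i\<in>{1..r}. \<forall>j\<in>{1..r}. i \<noteq> j \<longrightarrow> \<not> (\<exists>B\<in>P. i \<in> B \<and> j \<in> B))}"

text \<open>
  The ring of \<open>p\<close>-adic integers as the inverse limit of the rings \<open>\<int>/p\<^sup>i\<int>\<close>: an element is
  the sequence of its residues, the \<open>i\<close>-th one represented in \<open>{0..<p\<^sup>i}\<close>.
\<close>

definition padic_int :: "nat \<Rightarrow> (nat \<Rightarrow> int) ring" where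
  "padic_int p =
     \<lparr> carrier = {a. (\<forall>i. a i \<in> {0..<int p ^ i}) \<and> (\<forall>i. a (Suc i) mod int p ^ i = a i)},
       mult = (\<lambda>a b i. (a i * b i) mod int p ^ i),
       one = (\<lambda>i. 1 mod int p ^ i),
       zero = (\<lambda>i. 0),
       add = (\<lambda>a b i. (a i + b i) mod int p ^ i) \<rparr>"

lemma padic_int_cring:
  assumes "p > 0"
  shows "cring (padic_int p)"
proof (rule cringI)
  have pos: "int p ^ i > 0" for i using assms by simp
  have red: "(x mod int p ^ Suc i) mod int p ^ i = x mod int p ^ i" for x i
    by (rule mod_mod_cancel) (simp add: dvd_def mult.commute)
  show "abelian_group (padic_int p)"
  proof (rule abelian_groupI)
    fix x y assume "x \<in> carrier (padic_int p)" "y \<in> carrier (padic_int p)"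
    then have "(x (Suc i) + y (Suc i)) mod int p ^ i = (x i + y i) mod int p ^ i" for i
      by (simp add: padic_int_def) (metis mod_add_eq)
    then show "x \<oplus>\<^bsub>padic_int p\<^esub> y \<in> carrier (padic_int p)"
      using pos red by (simp add: padic_int_def del: power_Suc)
  next
    fix x assume x: "x \<in> carrier (padic_int p)"
    then have eq: "(- x (Suc i)) mod int p ^ i = (- x i) mod int p ^ i" for i
      by (simp add: padic_int_def) (metis mod_minus_eq)
    show "\<exists>y\<in>carrier (padic_int p). y \<oplus>\<^bsub>padic_int p\<^esub> x = \<zero>\<^bsub>padic_int p\<^esub>"
      by (rule bexI[of _ "\<lambda>i. (- x i) mod int p ^ i"])
        (use pos red eq in \<open>simp_all add: padic_int_def mod_simps del: power_Suc\<close>)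
  qed (use assms in \<open>auto simp: padic_int_def mod_simps fun_eq_iff algebra_simps\<close>)
  show "Group.comm_monoid (padic_int p)"
  proof (rule comm_monoidI)
    fix x y assume "x \<in> carrier (padic_int p)" "y \<in> carrier (padic_int p)"
    then have "(x (Suc i) * y (Suc i)) mod int p ^ i = (x i * y i) mod int p ^ i" for i
      by (simp add: padic_int_def) (metis mod_mult_eq)
    then show "x \<otimes>\<^bsub>padic_int p\<^esub> y \<in> carrier (padic_int p)"
      using pos red by (simp add: padic_int_def del: power_Suc)
  next
    show "\<one>\<^bsub>padic_int p\<^esub> \<in> carrier (padic_int p)"
      using pos red by (simp add: padic_int_def del: power_Suc)
  qed (auto simp: padic_int_def mod_simps fun_eq_iff algebra_simps)
qed (auto simp: padic_int_def mod_simps fun_eq_iff algebra_simps)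

text \<open>
  \<open>rs_fubini R n r s\<close> is the image in \<open>R[x]\<close> of the polynomial \<open>\<F>\<^sub>n(x;r,s)\<close> over \<open>\<int>\<close>.
\<close>

definition rs_fubini :: "('a, 'm) ring_scheme \<Rightarrow> nat \<Rightarrow> nat \<Rightarrow> nat \<Rightarrow> (nat \<Rightarrow> 'a)" where
  "rs_fubini R n r s =
     (\<Oplus>\<^bsub>UP R\<^esub> k\<in>{0..n}.
        monom (UP R) ([(r_Stirling2 r (n + r) (k + r) * fact (k + s))] \<cdot>\<^bsub>R\<^esub> \<one>\<^bsub>R\<^esub>) k)"

definition poly_cong ::
  "('a, 'm) ring_scheme \<Rightarrow> nat \<Rightarrow> (nat \<Rightarrow> 'a) \<Rightarrow> (nat \<Rightarrow> 'a) \<Rightarrow> bool" where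
  "poly_cong R q A B \<longleftrightarrow>
     A \<in> carrier (UP R) \<and> B \<in> carrier (UP R) \<and>
     (\<forall>i. coeff (UP R) A i \<ominus>\<^bsub>R\<^esub> coeff (UP R) B i \<in> PIdl\<^bsub>R\<^esub> ([q] \<cdot>\<^bsub>R\<^esub> \<one>\<^bsub>R\<^esub>))"

end

theory Submission
  imports Defs "HOL-Number_Theory.Residues"
begin

text \<open>
  Set partitions satisfy the recurrence of the \<open>r\<close>-Stirling numbers, which gives
  \<open>i! S\<^sub>r(N + r, i + r) = \<Sum>\<^sub>j (-1)\<^sup>i\<^sup>+\<^sup>j (i choose j) (j + r)\<^sup>N\<close>. Since \<open>i!\<close> divides \<open>(i + s)!\<close>, the
  coefficient of \<open>x\<^sup>i\<close> on both sides is the same integer combination, over \<open>z = j + r\<close>, of the two sides of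
  \<open>\<Sum>\<^sub>k (-m)\<^sup>-\<^sup>k z\<^sup>n\<^sup>+\<^sup>k \<equiv> (-m)\<^sup>n ((z + m)\<^sup>p\<^sup>-\<^sup>1 - 1) (mod p)\<close>, where \<open>1 \<le> k < p\<close>. This congruence holds for
  every integer \<open>z\<close>: if \<open>z \<equiv> -m\<close> all summands on the left equal \<open>(-m)\<^sup>n\<close>; otherwise the left is a
  geometric sum of ratio different from 1, and both sides vanish by Fermat's theorem.
  A \<open>p\<close>-adic integer is divisible by \<open>p\<close> exactly if its residue modulo \<open>p\<close> is zero.
\<close>

section \<open>Separated set partitions and their recurrence\<close>

definition r_partitions :: "nat \<Rightarrow> nat \<Rightarrow> nat set set set" where
  "r_partitions r n = {P. partition_on {1..n} P \<and>
     (\<forall>i\<in>{1..r}. \<forall>j\<in>{1..r}. i \<noteq> j \<longrightarrow> \<not> (\<exists>B\<in>P. i \<in> B \<and> j \<in> B))}"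

lemma r_Stirling2_eq_card: "r_Stirling2 r n k = card {P \<in> r_partitions r n. card P = k}"
  unfolding r_Stirling2_def r_partitions_def by (rule arg_cong[of _ _ card]) auto

lemma finite_r_partitions: "finite (r_partitions r n)"
proof (rule finite_subset)
  show "r_partitions r n \<subseteq> Pow (Pow {1..n})"
    unfolding r_partitions_def partition_on_def by auto
qed simp

lemma Suc_notin_r_partitions: "Q \<in> r_partitions r n \<Longrightarrow> B \<in> Q \<Longrightarrow> Suc n \<notin> B"
  using Union_upper[of B Q] unfolding r_partitions_def partition_on_def by force

lemma r_partitions_finite: "P \<in> r_partitions r n \<Longrightarrow> finite P"
  unfolding r_partitions_def by (auto intro: finite_elements)

text \<open>
  In the pair \<open>(Q, C)\<close>, the block \<open>C\<close> of \<open>Q\<close> receives the new element \<open>N\<close>; \<open>C = {}\<close> encodes that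
  \<open>N\<close> forms a block of its own.
\<close>

definition insert_at :: "nat \<Rightarrow> nat set set \<times> nat set \<Rightarrow> nat set set" where
  "insert_at N = (\<lambda>(Q, C). insert (insert N C) (Q - {C}))"

text \<open>Intended inverse of \<open>insert_at\<close>. Subtracting \<open>{{}}\<close> discards
  what remains of a singleton block \<open>{N}\<close>; in a partition the union runs over the one
  block containing \<open>N\<close>.\<close>

definition remove_at :: "nat \<Rightarrow> nat set set \<Rightarrow> nat set set \<times> nat set" where
  "remove_at N P = ((\<lambda>B. B - {N}) ` P - {{}}, \<Union>{B \<in> P. N \<in> B} - {N})"

text \<open>This left inverse supplies the injectivity of \<open>insert_at\<close> needed for
  counting.\<close>

lemma remove_insert_at:
  assumes "Q \<in> r_partitions r n" "C \<in> insert {} Q"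
  shows "remove_at (Suc n) (insert_at (Suc n) (Q, C)) = (Q, C)"
proof -
  have notin: "Suc n \<notin> B" if "B \<in> insert {} Q" for B
    using Suc_notin_r_partitions[OF assms(1)] that by auto
  have ne: "{} \<notin> Q"
    using assms(1) unfolding r_partitions_def partition_on_def by auto
  have id: "(\<lambda>B. B - {Suc n}) ` (Q - {C}) = Q - {C}"
    using notin by (force simp: image_iff)
  have "(\<lambda>B. B - {Suc n}) ` insert_at (Suc n) (Q, C) = insert C (Q - {C})"
    using notin[OF assms(2)] id by (simp add: insert_at_def)
  moreover have "{B \<in> insert_at (Suc n) (Q, C). Suc n \<in> B} = {insert (Suc n) C}"
    using notin by (auto simp: insert_at_def)
  ultimately show ?thesis
    using notin[OF assms(2)] assms(2) ne by (auto simp: remove_at_def)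
qed

text \<open>Since \<open>r \<le> n\<close>, the new element lies outside \<open>{1..r}\<close>, so
  no separation condition can be violated by inserting it.\<close>

lemma insert_at_in_r_partitions:
  assumes "r \<le> n" "Q \<in> r_partitions r n" "C \<in> insert {} Q"
  shows "insert_at (Suc n) (Q, C) \<in> r_partitions r (Suc n)"
proof -
  have Q: "partition_on {1..n} Q"
    and sep: "\<And>i j B. i \<in> {1..r} \<Longrightarrow> j \<in> {1..r} \<Longrightarrow> i \<noteq> j \<Longrightarrow> B \<in> Q \<Longrightarrow> i \<in> B \<Longrightarrow> j \<in> B \<Longrightarrow> False"
    using assms(2) unfolding r_partitions_def by blast+
  have U: "\<Union>Q = {1..n}" and ne: "{} \<notin> Q" 
    and dis: "\<And>A B. A \<in> Q \<Longrightarrow> B \<in> Q \<Longrightarrow> A \<noteq> B \<Longrightarrow> A \<inter> B = {}"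
    using Q unfolding partition_on_def disjoint_def by auto
  have "partition_on {1..Suc n} (insert_at (Suc n) (Q, C))"
  proof (rule partition_onI)
    have "\<Union>(insert_at (Suc n) (Q, C)) = insert (Suc n) (\<Union>Q)"
      using assms(3) by (auto simp: insert_at_def)
    then show "\<Union>(insert_at (Suc n) (Q, C)) = {1..Suc n}"
      using U by auto
  next
    fix A B assume "A \<in> insert_at (Suc n) (Q, C)" "B \<in> insert_at (Suc n) (Q, C)" "A \<noteq> B"
    moreover have "Suc n \<notin> \<Union>Q" using U by simp
    ultimately show "disjnt A B"
      using dis assms(3) unfolding disjnt_def insert_at_def by auto
  qed (use ne in \<open>auto simp: insert_at_def\<close>)
  moreover have False if "i \<in> {1..r}" "j \<in> {1..r}" "i \<noteq> j"
    "B \<in> insert_at (Suc n) (Q, C)" "i \<in> B" "j \<in> B" for i j B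
    using that assms(1,3) sep[OF that(1-3)] by (auto simp: insert_at_def)
  ultimately show ?thesis
    unfolding r_partitions_def by blast
qed

lemma insert_at_surj:
  assumes "r \<le> n" "P \<in> r_partitions r (Suc n)"
  shows "P \<in> insert_at (Suc n) ` (SIGMA Q : r_partitions r n. insert {} Q)"
proof -
  have P: "partition_on {1..Suc n} P"
    and sep: "\<And>i j B. i \<in> {1..r} \<Longrightarrow> j \<in> {1..r} \<Longrightarrow> i \<noteq> j \<Longrightarrow> B \<in> P \<Longrightarrow> i \<in> B \<Longrightarrow> j \<in> B \<Longrightarrow> False"
    using assms(2) unfolding r_partitions_def by blast+
  have U: "\<Union>P = {1..Suc n}" and ne: "{} \<notin> P" 
    and dis: "\<And>A B x. A \<in> P \<Longrightarrow> B \<in> P \<Longrightarrow> x \<in> A \<Longrightarrow> x \<in> B \<Longrightarrow> A = B"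
    using P unfolding partition_on_def disjoint_def by auto
  have "Suc n \<in> \<Union>P" using U by simp
  then obtain D where D: "D \<in> P" "Suc n \<in> D" by blast
  define C where "C = D - {Suc n}"
  \<comment> \<open>If \<open>D = {Suc n}\<close>, then \<open>C\<close> is empty and must not
    survive as a block; subtracting \<open>{{}}\<close> covers this case.\<close>
  define Q where "Q = (P - {D}) \<union> ({C} - {{}})"
  have DC: "D = insert (Suc n) C" "Suc n \<notin> C" using D by (auto simp: C_def)
  have notin: "Suc n \<notin> B" if "B \<in> P - {D}" for B using dis[of B D] D that by auto
  \<comment> \<open>Without this, \<open>Q - {C}\<close> could lose a block other than the shortened
    \<open>D\<close>, and inserting \<open>Suc n\<close> again would not restore
    \<open>P\<close>.\<close>
  have CD: "C \<notin> P - {D}"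
  proof
    assume "C \<in> P - {D}"
    then have "C \<noteq> {}" "C \<in> P" "C \<noteq> D" using ne by auto
    then obtain x where "x \<in> C" by auto
    then show False using dis[of C D x] D \<open>C \<in> P\<close> \<open>C \<noteq> D\<close> by (auto simp: C_def)
  qed
  have "partition_on {1..n} Q"
  proof (rule partition_onI)
    have "\<Union>Q = \<Union>P - {Suc n}" 
      using notin D by (auto simp: Q_def C_def)
    then show "\<Union>Q = {1..n}" using U by auto
  next
    fix A B assume AB: "A \<in> Q" "B \<in> Q" "A \<noteq> B"
    have "disjnt A' B'" if "A' \<in> P" "B' \<in> P" "A' \<noteq> B'" for A' B'
      using dis that unfolding disjnt_def by blast
    then show "disjnt A B"
      using AB D by (fastforce simp: Q_def C_def disjnt_def)
  qed (use ne in \<open>auto simp: Q_def\<close>)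
  moreover have False if "i \<in> {1..r}" "j \<in> {1..r}" "i \<noteq> j" "B \<in> Q" "i \<in> B" "j \<in> B" for i j B
    using that sep[OF that(1-3), of B] sep[OF that(1-3), of D] D by (auto simp: Q_def C_def)
  ultimately have "Q \<in> r_partitions r n"
    unfolding r_partitions_def by blast
  moreover have "C \<in> insert {} Q" by (auto simp: Q_def)
  moreover have "P = insert_at (Suc n) (Q, C)"
    using D CD ne DC by (auto simp: insert_at_def Q_def)
  ultimately show ?thesis by (auto simp: image_iff)
qed

text \<open>The enlarged block is never in \<open>Q\<close>, so it adds one; a nonempty
  \<open>C\<close> is taken out in exchange.\<close>

lemma card_insert_at:
  assumes "Q \<in> r_partitions r n" "C \<in> insert {} Q"
  shows "card (insert_at (Suc n) (Q, C)) = (if C = {} then Suc (card Q) else card Q)"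
proof -
  have "{} \<notin> Q"
    using assms(1) unfolding r_partitions_def partition_on_def by auto
  moreover have "insert (Suc n) C \<notin> Q"
    using Suc_notin_r_partitions[OF assms(1)] by blast
  ultimately show ?thesis
    using assms(2) r_partitions_finite[OF assms(1)] card_Suc_Diff1[of Q C]
    by (cases "C = {}") (simp_all add: insert_at_def)
qed

text \<open>The element \<open>Suc n\<close> either joins one of the \<open>Suc k\<close> blocks of
  a smaller partition or is added as a singleton to a partition with \<open>k\<close>
  blocks.\<close>

lemma r_Stirling2_Suc_Suc:
  assumes "r \<le> n"
  shows "r_Stirling2 r (Suc n) (Suc k) = Suc k * r_Stirling2 r n (Suc k) + r_Stirling2 r n k"
proof -
  let ?A = "\<lambda>k. {Q \<in> r_partitions r n. card Q = k}"
  \<comment> \<open>\<open>?T\<close> collects the pairs of \<open>?S\<close> whose image has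
    exactly \<open>Suc k\<close> blocks: first the singleton case, then the choice of a
    block.\<close>
  let ?T = "?A k \<times> {{}} \<union> (SIGMA Q : ?A (Suc k). Q)"
  let ?S = "SIGMA Q : r_partitions r n. insert {} Q"
  have ne: "{} \<notin> Q" if "Q \<in> r_partitions r n" for Q
    using that unfolding r_partitions_def partition_on_def by auto
  have inj: "inj_on (insert_at (Suc n)) ?S"
    by (rule inj_on_inverseI[of _ "remove_at (Suc n)"]) (use remove_insert_at in blast)
  have sub: "?T \<subseteq> ?S" by auto
  have "{P \<in> r_partitions r (Suc n). card P = Suc k} = insert_at (Suc n) ` ?T"
  proof (intro equalityI subsetI)
    fix P assume P: "P \<in> {P \<in> r_partitions r (Suc n). card P = Suc k}"
    then obtain Q C where QC: "Q \<in> r_partitions r n" "C \<in> insert {} Q" "P = insert_at (Suc n) (Q, C)"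
      using insert_at_surj[OF assms, of P] by auto
    then have "(Q, C) \<in> ?T" using P card_insert_at[OF QC(1,2)] by (auto split: if_splits)
    then show "P \<in> insert_at (Suc n) ` ?T" using QC by blast
  next
    fix P assume "P \<in> insert_at (Suc n) ` ?T"
    then obtain Q C where QC: "(Q, C) \<in> ?T" "P = insert_at (Suc n) (Q, C)" by auto
    then have "Q \<in> r_partitions r n" "C \<in> insert {} Q" by auto
    then show "P \<in> {P \<in> r_partitions r (Suc n). card P = Suc k}"
      using QC card_insert_at[of Q r n C] insert_at_in_r_partitions[OF assms, of Q C] ne[of Q]
      by auto
  qed
  then have "r_Stirling2 r (Suc n) (Suc k) = card ?T"
    unfolding r_Stirling2_eq_card using card_image[OF inj_on_subset[OF inj sub]] by simp
  also have "\<dots> = card (?A k \<times> {{}::nat set}) + card (SIGMA Q : ?A (Suc k). Q)"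
    using ne by (intro card_Un_disjoint finite_SigmaI finite_cartesian_product)
      (auto simp: finite_r_partitions r_partitions_finite)
  also have "card (SIGMA Q : ?A (Suc k). Q) = (\<Sum>Q\<in>?A (Suc k). card Q)"
    by (intro card_SigmaI) (auto simp: finite_r_partitions r_partitions_finite)
  also have "\<dots> = Suc k * card (?A (Suc k))" by simp
  finally show ?thesis
    unfolding r_Stirling2_eq_card by (simp add: card_cartesian_product)
qed

section \<open>Boundary values and explicit formula\<close>

lemma r_Stirling2_Suc_0: "r_Stirling2 r (Suc n) 0 = 0"
proof -
  have "card P \<noteq> 0" if "P \<in> r_partitions r (Suc n)" for P
    using that r_partitions_finite[OF that] 
    unfolding r_partitions_def partition_on_def by auto
  then show ?thesis unfolding r_Stirling2_eq_card by (auto simp: card_eq_0_iff)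
qed

text \<open>When all elements must be separated, the partition into singletons is the only
  one.\<close>

lemma r_Stirling2_self: "r_Stirling2 r r k = (if k = r then 1 else 0)"
proof -
  let ?S = "(\<lambda>i. {i}) ` {1..r}"
  have "P = ?S" if "P \<in> r_partitions r r" for P
  proof -
    have P: "\<Union>P = {1..r}" "{} \<notin> P"
      using that unfolding r_partitions_def partition_on_def by auto
    have sep: "i = j" if "B \<in> P" "i \<in> B" "j \<in> B" for i j B
      using \<open>P \<in> r_partitions r r\<close> that P(1) unfolding r_partitions_def by blast
    have single: "B = {i}" if "B \<in> P" "i \<in> B" for B i
      using sep[OF that] that by blast
    show ?thesis
    proof (intro equalityI subsetI)
      fix B assume B: "B \<in> P"
      then obtain i where "i \<in> B" using P(2) by fastforce
      then show "B \<in> ?S" using single[OF B] B P(1) by blast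
    next
      fix B assume "B \<in> ?S"
      then obtain i where i: "i \<in> {1..r}" "B = {i}" by blast
      then obtain D where "D \<in> P" "i \<in> D" using P(1) by blast
      then show "B \<in> P" using single i by metis
    qed
  qed
  moreover have "?S \<in> r_partitions r r"
    unfolding r_partitions_def partition_on_def disjoint_def by auto
  ultimately have "r_partitions r r = {?S}" by blast
  moreover have "card ?S = r" by (simp add: card_image)
  ultimately have "{P \<in> r_partitions r r. card P = k} = (if k = r then {?S} else {})"
    by auto
  then show ?thesis unfolding r_Stirling2_eq_card by simp
qed

lemma r_Stirling2_eq_0_low:
  assumes "r \<le> n" "k < r"
  shows "r_Stirling2 r n k = 0"
  using assms
proof (induction n arbitrary: k rule: dec_induct)
  case base
  then show ?case by (simp add: r_Stirling2_self)
next
  case (step n)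
  then show ?case by (cases k) (simp_all add: r_Stirling2_Suc_0 r_Stirling2_Suc_Suc)
qed

lemma r_Stirling2_eq_0_high:
  assumes "r \<le> n" "n < k"
  shows "r_Stirling2 r n k = 0"
  using assms
proof (induction n arbitrary: k rule: dec_induct)
  case base
  then show ?case by (simp add: r_Stirling2_self)
next
  case (step n)
  then show ?case by (cases k) (simp_all add: r_Stirling2_Suc_Suc)
qed

text \<open>The case \<open>k = 0\<close> is split off because truncated subtraction would turn the
  lower index \<open>r - 1\<close>, where the number vanishes, into \<open>r\<close>.\<close>

lemma r_Stirling2_rec:
  "r_Stirling2 r (Suc n + r) (k + r) =
     (k + r) * r_Stirling2 r (n + r) (k + r) + (if k = 0 then 0 else r_Stirling2 r (n + r) (k - 1 + r))"
proof (cases "k + r")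
  case 0
  then show ?thesis by (simp add: r_Stirling2_Suc_0)
next
  case (Suc l)
  have "r_Stirling2 r (n + r) l = (if k = 0 then 0 else r_Stirling2 r (n + r) (k - 1 + r))"
    using Suc by (cases k) (auto simp: r_Stirling2_eq_0_low)
  then show ?thesis
    using Suc r_Stirling2_Suc_Suc[of r "n + r" l] by simp
qed

text \<open>Induction on \<open>n\<close>: multiplied by \<open>fact k\<close>, the recurrence
  expresses the left side at \<open>Suc n\<close> through those at \<open>n\<close> for
  \<open>k\<close> and \<open>k - 1\<close>. The sum obeys the same rule, and for
  \<open>n = 0\<close> it is the alternating sum of binomial coefficients.\<close>

lemma fact_r_Stirling2:
  "int (fact k * r_Stirling2 r (n + r) (k + r)) =
     (\<Sum>j\<le>k. (-1) ^ (k + j) * int (k choose j) * int (j + r) ^ n)"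
proof (induction n arbitrary: k)
  case 0
  have "(\<Sum>j\<le>k. (-1) ^ (k + j) * int (k choose j)) = (-1) ^ k * (\<Sum>j\<le>k. (-1) ^ j * int (k choose j))"
    by (simp add: sum_distrib_left power_add mult.assoc)
  also have "\<dots> = (if k = 0 then 1 else 0)"
    using choose_alternating_sum[of k, where 'a=int] by auto
  finally show ?case by (simp add: r_Stirling2_self)
next
  case (Suc n)
  let ?E = "\<lambda>k. (\<Sum>j\<le>k. (-1) ^ (k + j) * int (k choose j) * int (j + r) ^ n)"
  \<comment> \<open>One factor \<open>j + r\<close> is split as \<open>(k + r) - (k - j)\<close>;
    the second part is absorbed by \<open>(k - j) * (k choose j) = k * (k - 1 choose j)\<close>,
    with a change of sign.\<close>
  have "(\<Sum>j\<le>k. (-1) ^ (k + j) * int (k choose j) * int (j + r) ^ Suc n)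
    = int (k + r) * ?E k - (\<Sum>j\<le>k. (-1) ^ (k + j) * (int (k - j) * int (k choose j)) * int (j + r) ^ n)"
    unfolding sum_distrib_left sum_subtractf[symmetric]
    by (rule sum.cong) (auto simp: algebra_simps of_nat_diff)
  also have "(\<Sum>j\<le>k. (-1) ^ (k + j) * (int (k - j) * int (k choose j)) * int (j + r) ^ n)
     = (if k = 0 then 0 else - int k * ?E (k - 1))"
  proof (cases k)
    case (Suc l)
    have "int (k - j) * int (k choose j) = int k * int (l choose j)" if "j \<le> l" for j
    proof -
      have "(k - j) * (k choose j) = k * (l choose j)"
        using binomial_absorb_comp[of k j] Suc by simp
      then show ?thesis by (simp only: flip: of_nat_mult)
    qed
    then have "(\<Sum>j\<le>l. (-1) ^ (k + j) * (int (k - j) * int (k choose j)) * int (j + r) ^ n)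
      = - int k * ?E l"
      unfolding sum_distrib_left by (intro sum.cong) (auto simp: Suc algebra_simps)
    then show ?thesis by (simp add: Suc)
  qed simp
  finally have "(\<Sum>j\<le>k. (-1) ^ (k + j) * int (k choose j) * int (j + r) ^ Suc n)
    = int (k + r) * ?E k + (if k = 0 then 0 else int k * ?E (k - 1))" by simp
  also have "\<dots> = int (fact k * r_Stirling2 r (Suc n + r) (k + r))"
    unfolding Suc.IH[symmetric] r_Stirling2_rec 
    by (cases k) (simp_all add: algebra_simps)
  finally show ?case by simp
qed

section \<open>Power sums modulo a prime\<close>

lemma sum_power_cong_shifted_power:
  fixes z d :: int
  assumes p: "prime p" and d: "[d * (- int m) = 1] (mod int p)"
  shows "[(\<Sum>k=1..p-1. d ^ k * z ^ (n + k)) = (- int m) ^ n * ((z + int m) ^ (p - 1) - 1)] (mod int p)"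
proof (cases "[z = - int m] (mod int p)")
  case True
  have summand: "[d ^ k * z ^ (n + k) = (- int m) ^ n] (mod int p)" for k
  proof -
    have "[d ^ k * z ^ (n + k) = d ^ k * (- int m) ^ (n + k)] (mod int p)"
      by (intro cong_mult cong_pow True cong_refl)
    also have "d ^ k * (- int m) ^ (n + k) = (d * (- int m)) ^ k * (- int m) ^ n"
      by (simp only: power_add power_mult_distrib mult_ac)
    also have "[\<dots> = 1 ^ k * (- int m) ^ n] (mod int p)"
      by (intro cong_mult cong_pow d cong_refl)
    finally show ?thesis by simp
  qed
  have "[(\<Sum>k=1..p-1. d ^ k * z ^ (n + k)) = (\<Sum>k=1..p-1. (- int m) ^ n)] (mod int p)"
    by (intro cong_sum summand)
  also have "(\<Sum>k=1..p-1. (- int m) ^ n) = (- int m) ^ n * (int p - 1)"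
    using prime_ge_1_nat[OF p] by (simp add: of_nat_diff mult.commute)
  \<comment> \<open>The number \<open>p - 1\<close> of summands is -1 modulo \<open>p\<close>. The 0
    stands for \<open>(z + int m) ^ (p - 1)\<close>, whose base is divisible by \<open>p\<close> and
    whose exponent is positive.\<close>
  also have "[\<dots> = (- int m) ^ n * (0 - 1)] (mod int p)"
    by (intro cong_mult cong_diff cong_refl) (simp add: cong_def)
  also have "[(- int m) ^ n * (0 - 1) = (- int m) ^ n * ((z + int m) ^ (p - 1) - 1)] (mod int p)"
  proof (intro cong_mult cong_diff cong_refl)
    have "[(z + int m) ^ (p - 1) = (- int m + int m) ^ (p - 1)] (mod int p)"
      by (intro cong_pow cong_add True cong_refl)
    then show "[0 = (z + int m) ^ (p - 1)] (mod int p)"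
      using prime_gt_1_nat[OF p] by (simp add: cong_sym_eq power_0_left)
  qed
  finally show ?thesis .
next
  case False
  have fermat: "[a ^ (p - 1) = 1] (mod int p)" if "\<not> int p dvd a" for a
  proof -
    have "coprime a (int p)"
      using that p prime_imp_coprime[of "int p" a] by (simp add: coprime_commute)
    then have "[a ^ totient (nat (int p)) = 1] (mod int p)"
      using prime_gt_1_nat[OF p] by (intro residues.euler_theorem residues.intro) simp_all
    then show ?thesis using p by (simp add: totient_prime)
  qed
  have nd: "\<not> int p dvd z + int m"
    using False by (simp add: cong_iff_dvd_diff)
  \<comment> \<open>The ratio of the geometric sum. If it were 1 modulo \<open>p\<close>,
    multiplying by \<open>- int m\<close> would give \<open>z\<close> congruent to
    \<open>- int m\<close>.\<close>
  define w where "w = d * z"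
  have w: "\<not> int p dvd w - 1"
  proof
    assume "int p dvd w - 1"
    then have "[d * z * (- int m) = 1 * (- int m)] (mod int p)"
      by (intro cong_mult cong_refl) (simp add: cong_iff_dvd_diff w_def)
    moreover have "[d * (- int m) * z = 1 * z] (mod int p)"
      by (intro cong_mult cong_refl d)
    ultimately show False using False by (auto simp: cong_def mult_ac)
  qed
  \<comment> \<open>In the form \<open>w ^ p - w\<close>, Fermat's theorem also covers
    \<open>w\<close> divisible by \<open>p\<close>; the factor \<open>w - 1\<close> can then be
    cancelled.\<close>
  have "(w - 1) * (\<Sum>k=1..p-1. w ^ k) = w ^ p - w"
  proof -
    have "(w - 1) * (\<Sum>k=1..N. w ^ k) = w ^ Suc N - w" for N
      by (induction N) (simp_all add: algebra_simps)
    from this[of "p - 1"] show ?thesis using prime_gt_0_nat[OF p] by simp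
  qed
  moreover have "int p dvd w ^ p - w"
  proof (cases "int p dvd w")
    case True
    then show ?thesis using prime_gt_0_nat[OF p] by (intro dvd_diff dvd_power_le[of _ _ 1, simplified]) auto
  next
    case False
    have "w ^ p - w = w * (w ^ (p - 1) - 1)"
      using prime_gt_0_nat[OF p] by (simp add: algebra_simps flip: power_Suc)
    then show ?thesis using fermat[OF False] by (simp add: cong_iff_dvd_diff)
  qed
  ultimately have "int p dvd (\<Sum>k=1..p-1. w ^ k)"
    using w p prime_dvd_mult_iff[of "int p"] by (metis prime_nat_int_transfer)
  moreover have "(\<Sum>k=1..p-1. d ^ k * z ^ (n + k)) = z ^ n * (\<Sum>k=1..p-1. w ^ k)"
    by (simp add: sum_distrib_left w_def power_add power_mult_distrib mult_ac)
  ultimately have "[(\<Sum>k=1..p-1. d ^ k * z ^ (n + k)) = 0] (mod int p)"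
    by (simp add: cong_0_iff)
  moreover have "[(- int m) ^ n * ((z + int m) ^ (p - 1) - 1) = 0] (mod int p)"
    using fermat[OF nd] by (simp add: cong_0_iff cong_iff_dvd_diff)
  ultimately show ?thesis by (metis cong_sym cong_trans)
qed

lemma r_Stirling2_sum_cong:
  assumes p: "prime p" and d: "[d * (- int m) = 1] (mod int p)"
  shows "[(\<Sum>k=1..p-1. d ^ k * int (r_Stirling2 r (n + k + r) (i + r) * fact (i + s)))
     = (- int m) ^ n * (int (r_Stirling2 (r + m) (p - 1 + (r + m)) (i + (r + m)) * fact (i + s))
          - (if i = 0 then fact s else 0))] (mod int p)"
proof -
  have "fact i dvd (fact (i + s) :: nat)" by (simp add: fact_dvd)
  then obtain t where t: "(fact (i + s) :: nat) = fact i * t" by blast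
  define b where "b j = (-1) ^ (i + j) * int (i choose j)" for j
  have S: "int (r_Stirling2 q (N + q) (i + q) * fact (i + s)) = int t * (\<Sum>j\<le>i. b j * int (j + q) ^ N)"
    for q N
    using fact_r_Stirling2[of i q N] unfolding t b_def by (simp add: mult_ac)
  \<comment> \<open>The instance \<open>S\<close> with \<open>q = N = 0\<close>, where every power
    is 1. It produces the term \<open>fact s\<close>, which occurs only in the constant
    coefficient.\<close>
  have b_sum: "int t * (\<Sum>j\<le>i. b j) = (if i = 0 then fact s else 0)"
    using S[of 0 0] t by (auto simp: r_Stirling2_self)
  have "(\<Sum>k=1..p-1. d ^ k * int (r_Stirling2 r (n + k + r) (i + r) * fact (i + s)))
    = (\<Sum>k=1..p-1. \<Sum>j\<le>i. int t * (b j * (d ^ k * int (j + r) ^ (n + k))))"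
    unfolding S sum_distrib_left by (simp add: mult_ac)
  also have "\<dots> = int t * (\<Sum>j\<le>i. b j * (\<Sum>k=1..p-1. d ^ k * int (j + r) ^ (n + k)))"
    by (subst sum.swap) (simp add: sum_distrib_left)
  also have "[\<dots> = int t * (\<Sum>j\<le>i. b j * ((- int m) ^ n * ((int (j + r) + int m) ^ (p - 1) - 1)))] (mod int p)"
    by (intro cong_mult cong_sum cong_refl sum_power_cong_shifted_power p d)
  \<comment> \<open>Regrouping \<open>j + r + m\<close> as \<open>j + (r + m)\<close> lets
    \<open>S\<close> apply again, now with parameter \<open>r + m\<close> and exponent
    \<open>p - 1\<close>.\<close>
  also have "int t * (\<Sum>j\<le>i. b j * ((- int m) ^ n * ((int (j + r) + int m) ^ (p - 1) - 1)))
    = (- int m) ^ n * (int t * (\<Sum>j\<le>i. b j * int (j + (r + m)) ^ (p - 1)) - int t * (\<Sum>j\<le>i. b j))"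
    unfolding sum_distrib_left sum_subtractf[symmetric]
    by (rule sum.cong) (simp_all add: algebra_simps)
  finally show ?thesis
    unfolding S b_sum .
qed

section \<open>Residues, units and divisibility of p-adic integers\<close>

lemma padic_int_carrier_iff:
  "a \<in> carrier (padic_int p) \<longleftrightarrow>
     (\<forall>i. a i \<in> {0..<int p ^ i}) \<and> (\<forall>i. a (Suc i) mod int p ^ i = a i)"
  by (simp add: padic_int_def)

lemma padic_int_mod:
  assumes "a \<in> carrier (padic_int p)"
  shows "a i mod int p ^ i = a i"
  using assms by (simp add: padic_int_carrier_iff)

lemma padic_int_add_nth: "(a \<oplus>\<^bsub>padic_int p\<^esub> b) i = (a i + b i) mod int p ^ i"
  and padic_int_mult_nth: "(a \<otimes>\<^bsub>padic_int p\<^esub> b) i = (a i * b i) mod int p ^ i"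
  and padic_int_zero_nth: "\<zero>\<^bsub>padic_int p\<^esub> i = 0"
  and padic_int_one_nth: "\<one>\<^bsub>padic_int p\<^esub> i = 1 mod int p ^ i"
  by (simp_all add: padic_int_def)

lemma padic_int_of_nat_nth:
  assumes "p > 0"
  shows "([(k :: nat)] \<cdot>\<^bsub>padic_int p\<^esub> \<one>\<^bsub>padic_int p\<^esub>) i = int k mod int p ^ i"
proof -
  interpret R: cring "padic_int p" by (rule padic_int_cring[OF assms])
  show ?thesis
    by (induction k)
      (simp_all add: padic_int_add_nth padic_int_zero_nth padic_int_one_nth mod_simps ac_simps)
qed

lemma padic_int_uminus_nth:
  assumes "p > 0" "a \<in> carrier (padic_int p)"
  shows "(\<ominus>\<^bsub>padic_int p\<^esub> a) i = (- a i) mod int p ^ i"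
proof -
  interpret R: cring "padic_int p" by (rule padic_int_cring[OF assms(1)])
  let ?b = "\<ominus>\<^bsub>padic_int p\<^esub> a"
  have b: "?b \<in> carrier (padic_int p)" using assms(2) by simp
  have "(a \<oplus>\<^bsub>padic_int p\<^esub> ?b) i = 0"
    using assms(2) by (simp add: R.r_neg padic_int_zero_nth)
  then have "[a i + ?b i = 0] (mod int p ^ i)"
    by (simp add: padic_int_add_nth cong_def)
  then have "[?b i = - a i] (mod int p ^ i)"
    by (simp add: cong_iff_dvd_diff add.commute)
  then show ?thesis using padic_int_mod[OF b, of i] by (simp add: cong_def)
qed

lemma padic_int_minus_nth:
  assumes "p > 0" "a \<in> carrier (padic_int p)" "b \<in> carrier (padic_int p)"
  shows "(a \<ominus>\<^bsub>padic_int p\<^esub> b) i = (a i - b i) mod int p ^ i"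
  using assms by (simp add: a_minus_def padic_int_add_nth padic_int_uminus_nth mod_simps)

lemma padic_int_pow_nth:
  assumes "p > 0"
  shows "(a [^]\<^bsub>padic_int p\<^esub> (k :: nat)) i = a i ^ k mod int p ^ i"
proof -
  interpret R: cring "padic_int p" by (rule padic_int_cring[OF assms])
  show ?thesis
    by (induction k) (simp_all add: padic_int_mult_nth padic_int_one_nth mod_simps ac_simps)
qed

lemma padic_int_finsum_nth:
  assumes "p > 0" "finite A" "f \<in> A \<rightarrow> carrier (padic_int p)"
  shows "(\<Oplus>\<^bsub>padic_int p\<^esub> k\<in>A. f k) i = (\<Sum>k\<in>A. f k i) mod int p ^ i"
proof -
  interpret R: cring "padic_int p" by (rule padic_int_cring[OF assms(1)])
  show ?thesis
    using assms(2,3)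
    by (induction A) (simp_all add: padic_int_zero_nth padic_int_add_nth R.finsum_insert mod_simps)
qed

text \<open>Inverses exist modulo each \<open>p ^ i\<close>; their uniqueness makes the residues
  compatible. Index \<open>Suc 0\<close> is the residue modulo \<open>p\<close>, index 0 being
  trivial.\<close>

lemma padic_int_unitI:
  assumes p: "prime p" and a: "a \<in> carrier (padic_int p)" and nd: "\<not> int p dvd a (Suc 0)"
  shows "a \<in> Units (padic_int p)"
proof -
  have p0: "p > 0" using p by (rule prime_gt_0_nat)
  interpret R: cring "padic_int p" by (rule padic_int_cring[OF p0])
  have pos: "int p ^ i > 0" for i using p0 by simp
  have step: "[a (Suc i) = a i] (mod int p ^ i)" for i
    using a padic_int_mod[OF a, of i] by (simp add: padic_int_carrier_iff cong_def)
  have dvd_diff: "int p dvd a (Suc i) - a (Suc 0)" for i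
  proof (induction i)
    case (Suc i)
    have "int p dvd a (Suc (Suc i)) - a (Suc i)"
      using step[of "Suc i"] by (auto simp: cong_iff_dvd_diff intro: dvd_mult_left)
    from dvd_add[OF this Suc] show ?case by simp
  qed simp
  have cop: "coprime (a i) (int p ^ i)" for i
  proof (cases i)
    case (Suc j)
    have "\<not> int p dvd a (Suc j)"
      using dvd_diff[of j] nd dvd_diff_right_iff by (metis dvd_diff_commute dvd_diffD)
    then have "coprime (int p) (a i)"
      using p Suc by (intro prime_imp_coprime) auto
    then show ?thesis by (simp add: coprime_commute)
  qed simp
  then have "\<exists>x. [a i * x = 1] (mod int p ^ i)" for i
    using cong_solve_coprime_int by blast
  then obtain x where x: "\<And>i. [a i * x i = 1] (mod int p ^ i)" by metis
  define b where "b i = x i mod int p ^ i" for i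
  have ab: "[a i * b i = 1] (mod int p ^ i)" for i
    using x[of i] by (simp add: b_def cong_def mod_simps)
  have "b (Suc i) mod int p ^ i = b i" for i
  proof -
    have "[a (Suc i) * b (Suc i) = 1] (mod int p ^ i)"
      by (rule cong_dvd_modulus[OF ab[of "Suc i"]]) simp
    then have "[a i * b (Suc i) = 1] (mod int p ^ i)"
      using cong_scalar_right[OF step[of i], of "b (Suc i)"] by (metis cong_sym cong_trans)
    then have "[a i * b (Suc i) = a i * b i] (mod int p ^ i)"
      using ab[of i] by (metis cong_sym cong_trans)
    \<comment> \<open>Both are inverses of \<open>a i\<close> modulo \<open>p ^ i\<close>, and
      \<open>a i\<close> is cancellable there.\<close>
    then have "[b (Suc i) = b i] (mod int p ^ i)"
      using cong_mult_lcancel[OF cop] by blast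
    then show ?thesis by (simp add: cong_def b_def)
  qed
  then have b: "b \<in> carrier (padic_int p)"
    using pos by (simp add: padic_int_carrier_iff b_def)
  have "a \<otimes>\<^bsub>padic_int p\<^esub> b = \<one>\<^bsub>padic_int p\<^esub>"
    using ab by (simp add: fun_eq_iff padic_int_mult_nth padic_int_one_nth cong_def)
  then show ?thesis
    using a b R.m_comm[OF a b] by (auto simp: Units_def)
qed

lemma padic_int_in_PIdl:
  assumes "p > 0" and a: "a \<in> carrier (padic_int p)" and "a (Suc 0) = 0"
  shows "a \<in> PIdl\<^bsub>padic_int p\<^esub> ([p] \<cdot>\<^bsub>padic_int p\<^esub> \<one>\<^bsub>padic_int p\<^esub>)"
proof -
  have pos: "int p ^ i > 0" for i using assms(1) by simp
  have red: "a (Suc i) mod int p ^ i = a i" for i using a by (simp add: padic_int_carrier_iff)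
  have dvd: "int p dvd a (Suc i)" for i
  proof (induction i)
    case (Suc i)
    have "int p dvd a (Suc (Suc i)) mod int p ^ Suc i" using Suc by (simp only: red)
    then show ?case by (simp add: dvd_mod_iff)
  qed (use assms(3) in simp)
  \<comment> \<open>Division by \<open>p\<close> costs one power of the modulus, so the
    \<open>i\<close>-th residue of the quotient comes from the residue of \<open>a\<close> at
    \<open>Suc i\<close>.\<close>
  define b where "b i = a (Suc i) div int p" for i
  have pb: "int p * b i = a (Suc i)" for i
    using dvd by (simp add: b_def)
  have "0 \<le> b i \<and> b i < int p ^ i" for i
  proof -
    have "0 \<le> int p * b i" "int p * b i < int p * int p ^ i"
      using a by (simp_all add: pb padic_int_carrier_iff flip: power_Suc)
    then show ?thesis using assms(1) by (simp add: zero_le_mult_iff)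
  qed
  moreover have "b (Suc i) mod int p ^ i = b i" for i
  proof -
    have "int p * (b (Suc i) mod int p ^ i) = int p * b i"
      using red[of "Suc i"] by (simp add: mult_mod_right pb)
    then show ?thesis using assms(1) by simp
  qed
  ultimately have "b \<in> carrier (padic_int p)"
    by (simp add: padic_int_carrier_iff)
  moreover have "a = b \<otimes>\<^bsub>padic_int p\<^esub> ([p] \<cdot>\<^bsub>padic_int p\<^esub> \<one>\<^bsub>padic_int p\<^esub>)"
    by (simp add: fun_eq_iff padic_int_mult_nth padic_int_of_nat_nth[OF assms(1)] mod_simps
        mult.commute[of _ "int p"] pb red)
  ultimately show ?thesis unfolding cgenideal_def by blast
qed

section \<open>Coefficients of the Fubini polynomials and the final congruence\<close>

lemma rs_fubini_closed:
  assumes "cring R"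
  shows "rs_fubini R n r s \<in> carrier (UP R)"
proof -
  interpret R: cring R by fact
  interpret UP_cring R "UP R" by unfold_locales simp
  show ?thesis unfolding rs_fubini_def by (intro P.finsum_closed) simp
qed

text \<open>No bound on \<open>i\<close> is imposed: beyond degree \<open>n\<close> the r-Stirling
  number is zero, as is the coefficient.\<close>

lemma coeff_rs_fubini:
  assumes "cring R"
  shows "coeff (UP R) (rs_fubini R n r s) i =
    [(r_Stirling2 r (n + r) (i + r) * fact (i + s))] \<cdot>\<^bsub>R\<^esub> \<one>\<^bsub>R\<^esub>"
proof -
  interpret R: cring R by fact
  interpret UP_cring R "UP R" by unfold_locales simp
  let ?f = "\<lambda>k. [(r_Stirling2 r (n + r) (k + r) * fact (k + s))] \<cdot>\<^bsub>R\<^esub> \<one>\<^bsub>R\<^esub>"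
  have "coeff (UP R) (rs_fubini R n r s) i = (\<Oplus>\<^bsub>R\<^esub> k\<in>{0..n}. if i = k then ?f k else \<zero>\<^bsub>R\<^esub>)"
    unfolding rs_fubini_def by (subst coeff_finsum) (auto simp: eq_commute[of i] simp_implies_def intro!: R.finsum_cong)
  also have "\<dots> = ?f i"
  proof (cases "i \<le> n")
    case True
    then show ?thesis by (intro R.add.finprod_singleton) auto
  next
    case False
    then have "(\<Oplus>\<^bsub>R\<^esub> k\<in>{0..n}. if i = k then ?f k else \<zero>\<^bsub>R\<^esub>) = (\<Oplus>\<^bsub>R\<^esub> k\<in>{0..n}. \<zero>\<^bsub>R\<^esub>)"
      by (intro R.finsum_cong) auto
    then show ?thesis using False by (simp add: r_Stirling2_eq_0_high)
  qed
  finally show ?thesis .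
qed

theorem theorem13:
  fixes n m r s p :: nat
  defines "R \<equiv> padic_int p"
  defines "c \<equiv> \<ominus>\<^bsub>R\<^esub> ([m] \<cdot>\<^bsub>R\<^esub> \<one>\<^bsub>R\<^esub>)"
  assumes "prime p" and "\<not> p dvd m"
  shows "poly_cong R p
           (\<Oplus>\<^bsub>UP R\<^esub> k\<in>{1..p - 1}.
              inv\<^bsub>R\<^esub> (c [^]\<^bsub>R\<^esub> k) \<odot>\<^bsub>UP R\<^esub> rs_fubini R (n + k) r s)
           ((c [^]\<^bsub>R\<^esub> n) \<odot>\<^bsub>UP R\<^esub>
              (rs_fubini R (p - 1) (r + m) s
                \<ominus>\<^bsub>UP R\<^esub> monom (UP R) ([(fact s :: nat)] \<cdot>\<^bsub>R\<^esub> \<one>\<^bsub>R\<^esub>) 0))"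
    (is "poly_cong R p ?A ?B")
proof -
  have p0: "p > 0" using \<open>prime p\<close> by (rule prime_gt_0_nat)
  have R: "cring R" unfolding R_def by (rule padic_int_cring[OF p0])
  interpret R: cring R by fact
  interpret UP_cring R "UP R" by unfold_locales simp
  note [simp] = rs_fubini_closed[OF R]
  note nth = padic_int_mult_nth[of p, folded R_def] padic_int_zero_nth[of p, folded R_def]
    padic_int_of_nat_nth[OF p0, folded R_def] padic_int_minus_nth[OF p0, folded R_def]
    padic_int_pow_nth[OF p0, folded R_def]
  have c: "c \<in> carrier R" by (simp add: c_def)
  have c1: "c (Suc 0) = (- int m) mod int p"
    using padic_int_uminus_nth[OF p0, folded R_def, of "[m] \<cdot>\<^bsub>R\<^esub> \<one>\<^bsub>R\<^esub>" "Suc 0"]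
    by (simp add: c_def nth mod_simps)
  have "\<not> int p dvd c (Suc 0)"
    using \<open>\<not> p dvd m\<close> by (simp add: c1 dvd_mod_iff)
  then have unit: "c \<in> Units R"
    using c \<open>prime p\<close> unfolding R_def by (intro padic_int_unitI)
  \<comment> \<open>The residue modulo \<open>p\<close> of the p-adic inverse of \<open>c\<close>:
    an integer inverse of \<open>- int m\<close> as required by
    \<open>r_Stirling2_sum_cong\<close>.\<close>
  define d where "d = (inv\<^bsub>R\<^esub> c) (Suc 0)"
  have "(inv\<^bsub>R\<^esub> c \<otimes>\<^bsub>R\<^esub> c) (Suc 0) = 1 mod int p"
    using unit by (simp add: padic_int_one_nth[of p, folded R_def])
  then have d: "[d * (- int m) = 1] (mod int p)"
    by (simp add: nth c1 d_def cong_def mod_simps)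
  have ic: "inv\<^bsub>R\<^esub> c \<in> carrier R" using unit by simp
  \<comment> \<open>With powers of a single inverse, the residues of all scalars on the left become
    powers of \<open>d\<close>.\<close>
  have inv_pow: "inv\<^bsub>R\<^esub> (c [^]\<^bsub>R\<^esub> k) = (inv\<^bsub>R\<^esub> c) [^]\<^bsub>R\<^esub> k" for k :: nat
    using unit c ic by (intro R.comm_inv_char) (simp_all flip: R.nat_pow_distrib)
  have A: "?A \<in> carrier (UP R)"
    by (intro P.finsum_closed) (simp add: inv_pow ic)
  have B: "?B \<in> carrier (UP R)"
    using c by simp
  have "coeff (UP R) ?A i \<ominus>\<^bsub>R\<^esub> coeff (UP R) ?B i \<in> PIdl\<^bsub>R\<^esub> ([p] \<cdot>\<^bsub>R\<^esub> \<one>\<^bsub>R\<^esub>)" for i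
  proof -
    let ?S = "\<lambda>q N. r_Stirling2 q (N + q) (i + q) * fact (i + s)"
    have "coeff (UP R) ?A i = (\<Oplus>\<^bsub>R\<^esub> k\<in>{1..p-1}. (inv\<^bsub>R\<^esub> c) [^]\<^bsub>R\<^esub> k \<otimes>\<^bsub>R\<^esub> ([?S r (n + k)] \<cdot>\<^bsub>R\<^esub> \<one>\<^bsub>R\<^esub>))"
      by (subst coeff_finsum) (auto simp: inv_pow ic coeff_rs_fubini[OF R] intro!: R.finsum_cong)
    then have A1: "(coeff (UP R) ?A i) (Suc 0) = (\<Sum>k=1..p-1. d ^ k * int (?S r (n + k))) mod int p"
      using ic by (simp add: padic_int_finsum_nth[OF p0, folded R_def] nth d_def mod_simps mod_sum_eq
          del: of_nat_mult)
    have "coeff (UP R) ?B i = c [^]\<^bsub>R\<^esub> n \<otimes>\<^bsub>R\<^esub>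
      (([?S (r + m) (p - 1)] \<cdot>\<^bsub>R\<^esub> \<one>\<^bsub>R\<^esub>) \<ominus>\<^bsub>R\<^esub> (if i = 0 then [(fact s :: nat)] \<cdot>\<^bsub>R\<^esub> \<one>\<^bsub>R\<^esub> else \<zero>\<^bsub>R\<^esub>))"
      using c by (simp add: coeff_rs_fubini[OF R])
    then have B1: "(coeff (UP R) ?B i) (Suc 0) =
      ((- int m) ^ n * (int (?S (r + m) (p - 1)) - (if i = 0 then fact s else 0))) mod int p"
      using c by (simp add: nth c1 mod_simps del: of_nat_mult) (metis mod_diff_right_eq mod_mult_right_eq)
    \<comment> \<open>By \<open>padic_int_in_PIdl\<close>, equality of the residues modulo
      \<open>p\<close> suffices, which is the integer congruence for the coefficients.\<close>
    have eq: "(coeff (UP R) ?A i) (Suc 0) = (coeff (UP R) ?B i) (Suc 0)"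
      unfolding A1 B1
      using r_Stirling2_sum_cong[OF \<open>prime p\<close> d, of r n i s] unfolding cong_def .
    have "(coeff (UP R) ?A i \<ominus>\<^bsub>R\<^esub> coeff (UP R) ?B i) (Suc 0)
        = ((coeff (UP R) ?A i) (Suc 0) - (coeff (UP R) ?B i) (Suc 0)) mod int p ^ Suc 0"
      using A B by (intro padic_int_minus_nth[OF p0, folded R_def] coeff_closed)
    also have "\<dots> = 0" by (simp only: eq diff_self mod_0)
    finally have "(coeff (UP R) ?A i \<ominus>\<^bsub>R\<^esub> coeff (UP R) ?B i) (Suc 0) = 0" .
    with A B show ?thesis
      by (intro padic_int_in_PIdl[OF p0, folded R_def] R.minus_closed coeff_closed)
  qed
  then show ?thesis
    unfolding poly_cong_def using A B by blast
qed

end
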